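(* Let $\mathcal{B}\subset\mathbb{R}^m$ be convex and let $\Psi_i:\mathcal{B}\to\mathbb{R}$ be a quasiconcave function. Assume that the limiting parameters $\ell_{ij}\in[0,1]$ are such that $\Psi_i(U_i^{L,n+1}+\ell_{ij}P_{ij}^n)\ge0$ for all $j\in\mathcal{I}(i)\setminus\{i\}$. Then $$\Psi_i\bigg(\sum_{j\in\mathcal{I}(i)\setminus\{i\}}\lambda_j\,(U_i^{L,n+1}+\ell_{ij}P_{ij}^n)\bigg)\ge0.$$
   Context: $i$ is a fixed index, $\mathcal{I}(i)$ is a finite index set containing $i$ and at least one other index, $U_i^{L,n+1}\in\mathbb{R}^m$ (the low-order update) and $P_{ij}^n\in\mathbb{R}^m$, $j\in\mathcal{I}(i)\setminus\{i\}$, are given vectors, and $\{\lambda_j\}_{j\in\mathcal{I}(i)\setminus\{i\}}$ are strictly positive numbers with $\sum_{j\in\mathcal{I}(i)\setminus\{i\}}\lambda_j=1$. (In the paper $P_{ij}^n=\frac{1}{m_i\lambda_j}A_{ij}^n$, where $m_i>0$ and $A_{ij}^n$ is the difference of low-order and high-order fluxes times the time step.) A function $\Psi:\mathcal{B}\to\mathbb{R}$ on a convex set is quasiconcave if $\{U\in\mathcal{B}:\Psi(U)\ge\chi\}$ is convex for every $\chi\in\mathbb{R}$. The inequality $\Psi_i(V)\ge0$ means in particular that $V\in\mathcal{B}$. *)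

theory Defs
  imports "HOL-Analysis.Analysis"
begin

(* A function B \<rightarrow> \<real> is rendered as a total function of which only the values on B matter;
   hence the superlevel sets are taken inside B. *)
definition quasiconcave_on :: "'a::real_vector set \<Rightarrow> ('a \<Rightarrow> real) \<Rightarrow> bool"
  where "quasiconcave_on B \<Psi> \<longleftrightarrow> (\<forall>c. convex {U \<in> B. \<Psi> U \<ge> c})"

end

theory Submission
  imports Defs
begin

text \<open>The weights are positive and sum to one, so the limited update is a convex combination of
  the states \<^term>\<open>U + l j *\<^sub>R P j\<close>. All of these lie in the zero-superlevel set of the
  quasiconcave function, which is convex and hence contains the combination.\<close>

theorem lemma7p20:
  fixes B :: "(real ^ 'm) set"
    and \<Psi> :: "real ^ 'm \<Rightarrow> real"
    and i :: 'i
    and I :: "'i set"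
    and U :: "real ^ 'm"
    and P :: "'i \<Rightarrow> real ^ 'm"
    and lam :: "'i \<Rightarrow> real"
    and l :: "'i \<Rightarrow> real"
  assumes "finite I" and "i \<in> I" and "I - {i} \<noteq> {}"
    and "\<And>j. j \<in> I - {i} \<Longrightarrow> lam j > 0"
    and "(\<Sum>j\<in>I - {i}. lam j) = 1"
    and "convex B"
    and "quasiconcave_on B \<Psi>"
    and "\<And>j. j \<in> I - {i} \<Longrightarrow> l j \<in> {0..1}"
    and "\<And>j. j \<in> I - {i} \<Longrightarrow> U + l j *\<^sub>R P j \<in> B \<and> \<Psi> (U + l j *\<^sub>R P j) \<ge> 0"
  shows "(\<Sum>j\<in>I - {i}. lam j *\<^sub>R (U + l j *\<^sub>R P j)) \<in> B
    \<and> \<Psi> (\<Sum>j\<in>I - {i}. lam j *\<^sub>R (U + l j *\<^sub>R P j)) \<ge> 0"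
proof -
  let ?S = "{V \<in> B. \<Psi> V \<ge> 0}"
  have "convex ?S"
    using assms(7) unfolding quasiconcave_on_def by blast
  then have "(\<Sum>j\<in>I - {i}. lam j *\<^sub>R (U + l j *\<^sub>R P j)) \<in> ?S"
  proof (rule convex_sum[rotated])
    show "finite (I - {i})" using assms(1) by simp
    show "(\<Sum>j\<in>I - {i}. lam j) = 1" by (rule assms(5))
    show "lam j \<ge> 0" if "j \<in> I - {i}" for j using assms(4)[OF that] by simp
    show "U + l j *\<^sub>R P j \<in> ?S" if "j \<in> I - {i}" for j using assms(9)[OF that] by simp
  qed
  then show ?thesis by simp
qed

end
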